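(* For all integers $n>0$ the following hold: \begin{align*} M_{2}(0,4,4n) &> M_{2}(2,4,4n) > M_{2}(1,4,4n)\quad\text{for } n\ne 1,\\ M_{2}(2,4,4n+2) &> M_{2}(0,4,4n+2) > M_{2}(1,4,4n+2),\\ M_{2}(1,4,2n+1) &> M_{2}(0,4,2n+1) = M_{2}(2,4,2n+1),\\ M_{3}(0,4,2n) &> M_{3}(1,4,2n) = M_{3}(2,4,2n),\\ M_{3}(0,4,2n+1) &= M_{3}(1,4,2n+1) > M_{3}(2,4,2n+1),\\ M_{k}(0,4,n) &> M_{k}(1,4,n) > M_{k}(2,4,n)\quad\text{for every integer } k\ge 4. \end{align*}
   Context: A partition is a finite weakly decreasing (possibly empty) sequence of positive integers, called its parts; $\ell(\pi)$ denotes the number of parts of the partition $\pi$. For an integer $k\ge 2$, a $k$-colored partition of $n\ge 0$ is an ordered $k$-tuple $\overrightarrow{\pi}=(\pi^{(1)},\pi^{(2)},\dots,\pi^{(k)})$ of partitions (each possibly empty) such that the sum of all parts of all the $\pi^{(i)}$ equals $n$. Its $k$-crank is defined as $\ell(\pi^{(1)})-\ell(\pi^{(2)})$. For $m\in\mathbb{Z}$, $M_k(m,n)$ denotes the number of $k$-colored partitions of $n$ with $k$-crank equal to $m$; equivalently, $$\sum_{n\ge 0}\sum_{m\in\mathbb{Z}}M_k(m,n)z^mq^n=\frac{(q;q)_\infty^{2-k}}{(zq;q)_\infty(z^{-1}q;q)_\infty},\qquad (a;q)_\infty:=\prod_{i\ge 0}(1-aq^i).$$ With three arguments, $M_k(r,m,n)$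 denotes the number of $k$-colored partitions of $n$ whose $k$-crank is congruent to $r$ modulo $m$. *)

theory Defs
  imports "HOL-Number_Theory.Cong"
begin

definition is_partition :: "nat list \<Rightarrow> bool" where
  "is_partition p \<longleftrightarrow> sorted_wrt (\<ge>) p \<and> (\<forall>x\<in>set p. 0 < x)"

text \<open>
  A \<open>k\<close>-tuple is a list of length \<open>k\<close>, so the component
  with index \<open>i\<close> (counted from 1) is the list entry at position \<open>i - 1\<close>.
\<close>

definition colored_partitions :: "nat \<Rightarrow> nat \<Rightarrow> nat list list set" where
  "colored_partitions k n =
     {ps. length ps = k \<and> (\<forall>p\<in>set ps. is_partition p) \<and> sum_list (map sum_list ps) = n}"

text \<open>Only meaningful for tuples with at least two components, that is, for \<open>k \<ge> 2\<close>.\<close>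

definition crank :: "nat list list \<Rightarrow> int" where
  "crank ps = int (length (ps ! 0)) - int (length (ps ! 1))"

definition M :: "nat \<Rightarrow> int \<Rightarrow> int \<Rightarrow> nat \<Rightarrow> nat" where
  "M k r m n = card {ps \<in> colored_partitions k n. [crank ps = r] (mod m)}"

end

theory Submission
  imports Defs "HOL-Computational_Algebra.Formal_Laurent_Series"
begin

text \<open>
  Evaluate the crank generating function at \<open>z = \<i>\<close> and \<open>z = -1\<close>. The coefficients are
  \<open>M\<^sub>k(0,4,n) - M\<^sub>k(2,4,n)\<close> (and \<open>M\<^sub>k(1,4,n) = M\<^sub>k(3,4,n)\<close>) in the first case, and
  \<open>M\<^sub>k(0,4,n) + M\<^sub>k(2,4,n) - 2 M\<^sub>k(1,4,n)\<close> in the second. Let \<open>P(q)\<close> and \<open>R(q)\<close> be the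
  generating functions of all partitions and of partitions into distinct odd parts, and
  \<open>S(q) = R(-q)\<close>. By Euler's theorem the two series are \<open>S(q\<^sup>2) P(q)\<^bsup>k-2\<^esup>\<close> and
  \<open>S(q)\<^sup>2 P(q)\<^bsup>k-2\<^esup>\<close>. For \<open>k = 2\<close> the claims compare coefficients of \<open>R(q\<^sup>2)\<close> and \<open>R(q)\<^sup>2\<close>.
  For \<open>k \<ge> 3\<close>, the identities \<open>S(q) R(q) = S(q\<^sup>2)\<close> and \<open>S(q) P(q) = P(q\<^sup>2)\<close> turn the series
  into \<open>T(q) P(q)\<^bsup>k-3\<^esup>\<close> and \<open>T(-q) P(q)\<^bsup>k-3\<^esup>\<close> with \<open>T(q) = R(q) P(q\<^sup>2)\<close>, whose coefficients
  are all positive.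
\<close>

unbundle fps_syntax

section \<open>Infinite products of formal power series\<close>

text \<open>
  The condition \<open>f i = 1 + O(X\<^sup>i)\<close>, under which the factors beyond the \<open>n\<close>-th do not affect the
  coefficient of \<open>X\<^sup>n\<close> and the truncation in \<open>iprod\<close> is harmless.
\<close>

definition near_one :: "(nat \<Rightarrow> 'a::comm_ring_1 fps) \<Rightarrow> bool" where
  "near_one f \<longleftrightarrow> (\<forall>i\<ge>1. \<forall>j<i. f i $ j = 1 $ j)"

definition iprod :: "(nat \<Rightarrow> 'a::comm_ring_1 fps) \<Rightarrow> 'a fps" where
  "iprod f = Abs_fps (\<lambda>n. (\<Prod>i=1..n. f i) $ n)"

lemma fps_mult_nth_cong:
  fixes f g f' g' :: "'a::comm_ring_1 fps"
  assumes "\<And>j. j \<le> n \<Longrightarrow> f $ j = f' $ j" "\<And>j. j \<le> n \<Longrightarrow> g $ j = g' $ j"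
  shows "(f * g) $ n = (f' * g') $ n"
  using assms by (simp add: fps_mult_nth)

lemma iprod_nth:
  assumes "near_one f" "n \<le> N"
  shows "iprod f $ n = (\<Prod>i=1..N. f i) $ n"
  using assms(2)
proof (induction N rule: dec_induct)
  case base
  show ?case by (simp add: iprod_def)
next
  case (step N)
  have "((\<Prod>i=1..N. f i) * f (Suc N)) $ n = ((\<Prod>i=1..N. f i) * 1) $ n"
    using assms(1) step.hyps by (intro fps_mult_nth_cong) (auto simp: near_one_def)
  then show ?case
    using step.IH by (simp add: mult.commute)
qed

lemma iprod_mult:
  assumes "near_one f" "near_one g"
  shows "iprod f * iprod g = iprod (\<lambda>i. f i * g i)"
proof (rule fps_ext)
  fix n
  have "(iprod f * iprod g) $ n = ((\<Prod>i=1..n. f i) * (\<Prod>i=1..n. g i)) $ n"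
    using assms by (intro fps_mult_nth_cong) (auto simp: iprod_nth)
  then show "(iprod f * iprod g) $ n = iprod (\<lambda>i. f i * g i) $ n"
    by (simp add: iprod_def prod.distrib)
qed

text \<open>Coefficient \<open>n\<close> of a composition involves the outer series only up to
  degree \<open>n\<close>, so the product may be truncated before composing;
  \<open>h $ 0 = 0\<close> makes composition multiplicative.\<close>

lemma iprod_compose:
  fixes h :: "'a::idom fps"
  assumes "near_one f" "h $ 0 = 0"
  shows "iprod f oo h = iprod (\<lambda>i. f i oo h)"
proof (rule fps_ext)
  fix n
  have "(iprod f oo h) $ n = ((\<Prod>i=1..n. f i) oo h) $ n"
    using assms(1) by (simp add: fps_compose_nth iprod_nth[where N = n])
  then show "(iprod f oo h) $ n = iprod (\<lambda>i. f i oo h) $ n"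
    by (simp add: iprod_def fps_compose_prod_distrib[OF assms(2)])
qed

lemma iprod_reindex:
  assumes "near_one f" "c > 0"
  shows "iprod (\<lambda>i. f (c * i)) = iprod (\<lambda>i. if c dvd i then f i else 1)"
proof (rule fps_ext)
  fix n
  have "near_one (\<lambda>i. if c dvd i then f i else 1)"
    using assms by (auto simp: near_one_def)
  \<comment> \<open>Truncating at \<open>c * n\<close> instead of \<open>n\<close> leaves exactly
    the multiples \<open>c * i\<close> with \<open>i\<close> from 1 to \<open>n\<close>.\<close>
  moreover have "n \<le> c * n" using assms(2) by simp
  ultimately have "iprod (\<lambda>i. if c dvd i then f i else 1) $ n
      = (\<Prod>i=1..c*n. if c dvd i then f i else 1) $ n"
    by (rule iprod_nth)
  also have "(\<Prod>i=1..c*n. if c dvd i then f i else 1) = (\<Prod>i\<in>{i\<in>{1..c*n}. c dvd i}. f i)"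
    by (rule prod.inter_filter[symmetric]) simp
  also have "\<dots> = (\<Prod>i=1..n. f (c * i))"
    using assms(2)
    by (intro prod.reindex_bij_witness[where i = "\<lambda>i. c * i" and j = "\<lambda>i. i div c"])
       (auto elim!: dvdE)
  finally show "iprod (\<lambda>i. f (c * i)) $ n = iprod (\<lambda>i. if c dvd i then f i else 1) $ n"
    by (simp add: iprod_def)
qed

section \<open>Series with nonnegative coefficients and lower bounds for them\<close>

definition nonneg_fps :: "int fps \<Rightarrow> bool" where
  "nonneg_fps f \<longleftrightarrow> (\<forall>n. f $ n \<ge> 0)"

lemma nonneg_fps_mult: "nonneg_fps f \<Longrightarrow> nonneg_fps g \<Longrightarrow> nonneg_fps (f * g)"
  by (auto simp: nonneg_fps_def fps_mult_nth intro!: sum_nonneg)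

lemma nonneg_fps_prod: "(\<And>i. i \<in> S \<Longrightarrow> nonneg_fps (f i)) \<Longrightarrow> nonneg_fps (prod f S)"
proof (induction S rule: infinite_finite_induct)
  case (insert x S)
  then show ?case by (simp add: nonneg_fps_mult)
qed (auto simp: nonneg_fps_def)

text \<open>The discarded terms of the Cauchy product are nonnegative. Later bounds keep a few
  well-chosen indices \<open>J\<close>.\<close>

lemma nth_mult_ge:
  assumes "nonneg_fps f" "nonneg_fps g" "J \<subseteq> {0..n}"
  shows "(\<Sum>j\<in>J. f $ j * g $ (n - j)) \<le> (f * g) $ n"
  unfolding fps_mult_nth
  using assms by (intro sum_mono2) (auto simp: nonneg_fps_def)

lemma nonneg_fps_iprod:
  assumes "\<And>i. nonneg_fps (f i)"
  shows "nonneg_fps (iprod f)"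
  using nonneg_fps_prod[of _ f] assms by (simp add: nonneg_fps_def iprod_def)

text \<open>The factors outside \<open>S\<close> multiply to a nonnegative series with constant term
  1, so the term with \<open>J = {n}\<close> alone gives the bound.\<close>

lemma iprod_nth_ge:
  assumes "near_one f" "\<And>i. nonneg_fps (f i)" "S \<subseteq> {1..n}"
  shows "(\<Prod>i\<in>S. f i) $ n \<le> iprod f $ n"
proof -
  have "(\<Prod>i=1..n. f i) = (\<Prod>i\<in>S. f i) * (\<Prod>i\<in>{1..n} - S. f i)"
    using assms(3) by (subst prod.subset_diff[where B = S]) (auto simp: mult.commute)
  moreover have "(\<Prod>i\<in>T. f i) $ 0 = 1" if "T \<subseteq> {1..n}" for T
    using that
  proof (induction T rule: infinite_finite_induct)
    case (insert i T)
    then show ?case using assms(1) by (simp add: near_one_def)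
  qed auto
  moreover have "(\<Sum>j\<in>{n}. (\<Prod>i\<in>S. f i) $ j * (\<Prod>i\<in>{1..n} - S. f i) $ (n - j))
      \<le> ((\<Prod>i\<in>S. f i) * (\<Prod>i\<in>{1..n} - S. f i)) $ n"
    using assms(2) by (intro nth_mult_ge nonneg_fps_prod) auto
  ultimately show ?thesis by (simp add: iprod_def)
qed

section \<open>Colored partitions weighted by length\<close>

definition partitions :: "nat \<Rightarrow> nat list set" where
  "partitions n = {p. is_partition p \<and> sum_list p = n}"

text \<open>The bound on the parts matches the first \<open>N\<close> factors of the product and
  allows induction on \<open>N\<close>.\<close>

definition partitions_le :: "nat \<Rightarrow> nat \<Rightarrow> nat list set" where
  "partitions_le N n = {p\<in>partitions n. \<forall>x\<in>set p. x \<le> N}"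

lemma length_le_sum_list: "\<forall>x\<in>set p. 0 < x \<Longrightarrow> length p \<le> sum_list (p :: nat list)"
  by (induction p) auto

lemma finite_partitions: "finite (partitions n)"
proof (rule finite_subset)
  show "partitions n \<subseteq> {p. set p \<subseteq> {..n} \<and> length p \<le> n}"
    using length_le_sum_list member_le_sum_list
    by (fastforce simp: partitions_def is_partition_def)
qed (rule finite_lists_length_le, simp)

lemma finite_partitions_le: "finite (partitions_le N n)"
  by (simp add: partitions_le_def finite_partitions)

lemma partitions_le_self: "n \<le> N \<Longrightarrow> partitions_le N n = partitions n"
  using member_le_sum_list by (fastforce simp: partitions_le_def partitions_def)

text \<open>Parts decrease, so a part equal to \<open>Suc N\<close> must stand first; removing that
  one copy leaves a partition under the same bound.\<close>

lemma partitions_le_Suc: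
  "partitions_le (Suc N) n = partitions_le N n \<union>
     (if Suc N \<le> n then (#) (Suc N) ` partitions_le (Suc N) (n - Suc N) else {})"
  (is "?L = ?R")
proof (intro equalityI subsetI)
  fix p assume p: "p \<in> ?L"
  show "p \<in> ?R"
  proof (cases "\<forall>x\<in>set p. x \<le> N")
    case True
    then show ?thesis using p by (auto simp: partitions_le_def)
  next
    case False
    then obtain y ys where [simp]: "p = y # ys" by (cases p) auto
    have "y = Suc N"
      using p False by (force simp: partitions_le_def partitions_def is_partition_def)
    then show ?thesis
      using p by (auto simp: partitions_le_def partitions_def is_partition_def)
  qed
next
  fix p assume "p \<in> ?R"
  then show "p \<in> ?L"
    by (force simp: partitions_le_def partitions_def is_partition_def split: if_splits)
qed

text \<open>With \<open>X\<close> for q, this is 1/(zq; q)_inf, as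
  \<open>length_gf_mult_iprod\<close> confirms.\<close>

definition length_gf :: "'a::comm_ring_1 \<Rightarrow> 'a fps" where
  "length_gf z = Abs_fps (\<lambda>n. \<Sum>p\<in>partitions n. z ^ length p)"

text \<open>Splitting off one largest part gives A(N+1) = A(N) + z X^(N+1) A(N+1), so the new factor
  turns A(N+1) into A(N).\<close>

lemma length_gf_le_mult_prod:
  fixes z :: "'a::comm_ring_1"
  shows "Abs_fps (\<lambda>n. \<Sum>p\<in>partitions_le N n. z ^ length p)
     * (\<Prod>i=1..N. 1 - fps_const z * fps_X ^ i) = 1" (is "?A N * _ = 1")
proof (induction N)
  case 0
  have "partitions_le 0 n = (if n = 0 then {[]} else {})" for n
  proof -
    have "partitions_le 0 n \<subseteq> {[]}"
    proof
      fix p assume "p \<in> partitions_le 0 n"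
      then show "p \<in> {[]}"
        by (cases p) (auto simp: partitions_le_def partitions_def is_partition_def)
    qed
    moreover have "[] \<in> partitions_le 0 n \<longleftrightarrow> n = 0"
      by (auto simp: partitions_le_def partitions_def is_partition_def)
    ultimately show ?thesis by auto
  qed
  then show ?case by (auto simp: fps_eq_iff)
next
  case (Suc N)
  have rec: "?A (Suc N) = ?A N + fps_const z * fps_X ^ Suc N * ?A (Suc N)"
  proof (rule fps_ext)
    fix n
    let ?B = "if Suc N \<le> n then (#) (Suc N) ` partitions_le (Suc N) (n - Suc N) else {}"
    have "(\<Sum>p\<in>partitions_le (Suc N) n. z ^ length p)
        = (\<Sum>p\<in>partitions_le N n. z ^ length p) + (\<Sum>p\<in>?B. z ^ length p)"
      by (subst partitions_le_Suc, rule sum.union_disjoint)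
         (auto simp: finite_partitions_le, auto simp: partitions_le_def)
    also have "(\<Sum>p\<in>?B. z ^ length p)
        = (if n < Suc N then 0
           else z * (\<Sum>p\<in>partitions_le (Suc N) (n - Suc N). z ^ length p))"
      by (simp add: sum.reindex sum_distrib_left)
    finally show "?A (Suc N) $ n = (?A N + fps_const z * fps_X ^ Suc N * ?A (Suc N)) $ n"
      by (simp add: mult.assoc fps_X_power_mult_nth del: power_Suc)
  qed
  have "?A (Suc N) * (1 - fps_const z * fps_X ^ Suc N) = ?A N"
    using rec by (simp add: algebra_simps del: power_Suc)
  moreover have "?A (Suc N) * (\<Prod>i=1..Suc N. 1 - fps_const z * fps_X ^ i)
      = ?A (Suc N) * (1 - fps_const z * fps_X ^ Suc N) * (\<Prod>i=1..N. 1 - fps_const z * fps_X ^ i)"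
    by (subst prod.nat_ivl_Suc') (simp_all add: mult.assoc)
  ultimately show ?case
    using Suc.IH by (simp only:)
qed

lemma near_one_geometric: "near_one (\<lambda>i. 1 - fps_const z * fps_X ^ i)"
  by (auto simp: near_one_def)

text \<open>Up to degree \<open>n\<close> only parts and factors up to \<open>n\<close> matter,
  which reduces the claim to the finite product.\<close>

lemma length_gf_mult_iprod: "length_gf z * iprod (\<lambda>i. 1 - fps_const z * fps_X ^ i) = 1"
proof (rule fps_ext)
  fix n
  have "(length_gf z * iprod (\<lambda>i. 1 - fps_const z * fps_X ^ i)) $ n =
     (Abs_fps (\<lambda>m. \<Sum>p\<in>partitions_le n m. z ^ length p)
       * (\<Prod>i=1..n. 1 - fps_const z * fps_X ^ i)) $ n"
    by (intro fps_mult_nth_cong)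
       (auto simp: length_gf_def partitions_le_self iprod_nth[OF near_one_geometric])
  then show "(length_gf z * iprod (\<lambda>i. 1 - fps_const z * fps_X ^ i)) $ n = 1 $ n"
    by (simp only: length_gf_le_mult_prod)
qed

section \<open>Tuples of partitions with one weight per color\<close>

lemma colored_partitions_0: "colored_partitions 0 n = (if n = 0 then {[]} else {})"
  by (auto simp: colored_partitions_def)

lemma colored_partitions_Suc:
  "colored_partitions (Suc k) n =
     (\<lambda>(j, p, ps). p # ps) `
       (SIGMA j:{0..n}. partitions j \<times> colored_partitions k (n - j))"
  (is "?L = ?R")
proof (intro equalityI subsetI)
  fix qs assume "qs \<in> ?L"
  then obtain p ps where "qs = p # ps" "length ps = k" "is_partition p"
    "\<forall>p\<in>set ps. is_partition p" "sum_list p + sum_list (map sum_list ps) = n"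
    by (auto simp: colored_partitions_def length_Suc_conv)
  then show "qs \<in> ?R"
    by (intro image_eqI[where x = "(sum_list p, p, ps)"])
       (auto simp: colored_partitions_def partitions_def)
qed (auto simp: colored_partitions_def partitions_def)

lemma finite_colored_partitions: "finite (colored_partitions k n)"
proof (induction k arbitrary: n)
  case (Suc k)
  then show ?case
    by (simp add: colored_partitions_Suc finite_partitions)
qed (simp add: colored_partitions_0)

lemma colored_gf:
  fixes zs :: "'a::comm_ring_1 list"
  shows "Abs_fps (\<lambda>n. \<Sum>ps\<in>colored_partitions (length zs) n.
      prod_list (map2 (\<lambda>z p. z ^ length p) zs ps)) = prod_list (map length_gf zs)"
proof (induction zs)
  case Nil
  then show ?case by (auto simp: fps_eq_iff colored_partitions_0)
next
  case (Cons z zs)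
  let ?w = "\<lambda>zs ps. prod_list (map2 (\<lambda>z p. z ^ length p) zs ps) :: 'a"
  show ?case
  proof (rule fps_ext)
    fix n
    have inj: "inj_on (\<lambda>(j, p, ps). p # ps)
        (SIGMA j:{0..n}. partitions j \<times> colored_partitions (length zs) (n - j))"
      by (auto simp: inj_on_def partitions_def)
    have "(\<Sum>ps\<in>colored_partitions (length (z # zs)) n. ?w (z # zs) ps)
      = (\<Sum>(j, p, ps)\<in>(SIGMA j:{0..n}. partitions j \<times> colored_partitions (length zs) (n - j)).
          z ^ length p * ?w zs ps)"
      unfolding length_Cons colored_partitions_Suc sum.reindex[OF inj]
      by (simp add: case_prod_unfold)
    also have "\<dots> = (\<Sum>j=0..n. \<Sum>p\<in>partitions j.
        \<Sum>ps\<in>colored_partitions (length zs) (n - j). z ^ length p * ?w zs ps)"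
      by (simp add: sum.Sigma sum.cartesian_product finite_partitions finite_colored_partitions)
    also have "\<dots> = (length_gf z * prod_list (map length_gf zs)) $ n"
      unfolding Cons.IH[symmetric]
      by (simp add: fps_mult_nth length_gf_def sum_product)
    finally show "Abs_fps (\<lambda>n. \<Sum>ps\<in>colored_partitions (length (z # zs)) n. ?w (z # zs) ps) $ n
        = prod_list (map length_gf (z # zs)) $ n" by simp
  qed
qed

text \<open>Colors beyond the second get weight 1. If \<open>a * b = 1\<close>, this is the crank
  generating function at z = \<open>a\<close>.\<close>

lemma crank_gf:
  fixes a b :: "'a::comm_ring_1"
  shows "Abs_fps (\<lambda>n. \<Sum>ps\<in>colored_partitions (k + 2) n. a ^ length (ps ! 0) * b ^ length (ps ! 1))
    = length_gf a * length_gf b * length_gf 1 ^ k"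
proof -
  have 1: "prod_list (map2 (\<lambda>z p. z ^ length p) (replicate k (1::'a)) ps) = 1" for ps :: "nat list list"
  proof (induction k arbitrary: ps)
    case (Suc k)
    then show ?case by (cases ps) auto
  qed simp
  have "prod_list (map2 (\<lambda>z p. z ^ length p) (a # b # replicate k 1) ps)
      = a ^ length (ps ! 0) * b ^ length (ps ! 1)" if "ps \<in> colored_partitions (k + 2) n" for ps n
    using that 1 by (auto simp: colored_partitions_def length_Suc_conv numeral_2_eq_2)
  then have "Abs_fps (\<lambda>n. \<Sum>ps\<in>colored_partitions (k + 2) n. a ^ length (ps ! 0) * b ^ length (ps ! 1))
      = Abs_fps (\<lambda>n. \<Sum>ps\<in>colored_partitions (length (a # b # replicate k 1)) n.
          prod_list (map2 (\<lambda>z p. z ^ length p) (a # b # replicate k 1) ps))"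
    by (simp add: fps_eq_iff)
  also have "\<dots> = length_gf a * length_gf b * length_gf 1 ^ k"
    by (subst colored_gf) (simp add: mult.assoc prod_list_replicate)
  finally show ?thesis .
qed

section \<open>Partitions into distinct odd parts\<close>

text \<open>The product (-q; q^2)_inf. Even indices carry the factor 1 so that the exponent of each
  nontrivial factor equals its index, as \<open>near_one\<close> requires.\<close>

definition odd_distinct_gf :: "int fps" where
  "odd_distinct_gf = iprod (\<lambda>i. if odd i then 1 + fps_X ^ i else 1)"

abbreviation signed_odd_gf :: "int fps" where
  "signed_odd_gf \<equiv> odd_distinct_gf oo - fps_X"

lemma signed_odd_gf_eq: "signed_odd_gf = iprod (\<lambda>i. if odd i then 1 - fps_X ^ i else 1)"
proof -
  have "signed_odd_gf = iprod (\<lambda>i. (if odd i then 1 + fps_X ^ i else 1) oo - fps_X)"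
    unfolding odd_distinct_gf_def by (rule iprod_compose) (auto simp: near_one_def)
  also have "(\<lambda>i. (if odd i then 1 + fps_X ^ i else 1) oo - fps_X)
      = (\<lambda>i. if odd i then 1 - fps_X ^ i else 1 :: int fps)"
    by (auto simp: fun_eq_iff fps_compose_add_distrib fps_X_power_compose)
  finally show ?thesis .
qed

lemma signed_odd_gf_nth: "signed_odd_gf $ n = (-1) ^ n * odd_distinct_gf $ n"
  by (simp add: fps_compose_uminus')

section \<open>Product identities linking \<open>X\<close> and \<open>X\<^sup>2\<close>\<close>

lemma iprod_compose_square:
  fixes f :: "nat \<Rightarrow> 'a::idom fps"
  assumes "near_one f"
  shows "iprod f oo fps_X\<^sup>2 = iprod (\<lambda>i. f i oo fps_X\<^sup>2)"
  using assms by (rule iprod_compose) simp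

text \<open>Factorwise, (1 + X^i)(1 - X^i) = 1 - X^(2i) for odd \<open>i\<close>.\<close>

lemma odd_distinct_gf_mult_signed:
  "odd_distinct_gf * signed_odd_gf = signed_odd_gf oo fps_X\<^sup>2"
proof -
  have "odd_distinct_gf * signed_odd_gf =
      iprod (\<lambda>i. (if odd i then 1 + fps_X ^ i else 1) * (if odd i then 1 - fps_X ^ i else 1))"
    unfolding odd_distinct_gf_def signed_odd_gf_eq[unfolded odd_distinct_gf_def]
    by (rule iprod_mult) (auto simp: near_one_def)
  also have "(\<lambda>i. (if odd i then 1 + fps_X ^ i else 1) * (if odd i then 1 - fps_X ^ i else 1))
      = (\<lambda>i. (if odd i then 1 - fps_X ^ i else 1) oo (fps_X\<^sup>2 :: int fps))"
    by (auto simp: fun_eq_iff fps_compose_sub_distrib fps_X_power_compose algebra_simps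
             simp flip: power_mult power_add mult_2)
  also have "iprod \<dots> = signed_odd_gf oo fps_X\<^sup>2"
    unfolding signed_odd_gf_eq by (rule iprod_compose_square[symmetric]) (auto simp: near_one_def)
  finally show ?thesis .
qed

lemma euler_iprod_compose_square:
  "iprod (\<lambda>i. 1 - fps_X ^ i) oo fps_X\<^sup>2 = iprod (\<lambda>i. 1 - fps_X ^ (2 * i) :: 'a::idom fps)"
proof -
  have "iprod (\<lambda>i. 1 - fps_X ^ i) oo fps_X\<^sup>2 = iprod (\<lambda>i. (1 - fps_X ^ i) oo fps_X\<^sup>2 :: 'a fps)"
    by (rule iprod_compose_square) (auto simp: near_one_def)
  then show ?thesis
    by (simp add: fps_compose_sub_distrib fps_X_power_compose flip: power_mult)
qed

text \<open>The Euler product splits into its odd and its even exponents.\<close>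

lemma signed_odd_gf_mult_euler:
  "signed_odd_gf * (iprod (\<lambda>i. 1 - fps_X ^ i) oo fps_X\<^sup>2) = iprod (\<lambda>i. 1 - fps_X ^ i)"
proof -
  have "iprod (\<lambda>i. 1 - fps_X ^ (2 * i)) = iprod (\<lambda>i. if 2 dvd i then 1 - fps_X ^ i else 1 :: int fps)"
    by (rule iprod_reindex) (auto simp: near_one_def)
  then have "signed_odd_gf * (iprod (\<lambda>i. 1 - fps_X ^ i) oo fps_X\<^sup>2)
      = iprod (\<lambda>i. (if odd i then 1 - fps_X ^ i else 1) * (if 2 dvd i then 1 - fps_X ^ i else 1))"
    unfolding euler_iprod_compose_square signed_odd_gf_eq
    by (simp only:) (rule iprod_mult, auto simp: near_one_def)
  also have "(\<lambda>i. (if odd i then 1 - fps_X ^ i else 1) * (if 2 dvd i then 1 - fps_X ^ i else 1))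
      = (\<lambda>i. 1 - fps_X ^ i :: int fps)"
    by auto
  finally show ?thesis .
qed

lemma length_gf_1_mult_euler: "length_gf 1 * iprod (\<lambda>i. 1 - fps_X ^ i) = 1"
  using length_gf_mult_iprod[of 1] by simp

lemma signed_odd_gf_mult_length_gf:
  "signed_odd_gf * length_gf 1 = length_gf 1 oo fps_X\<^sup>2"
proof -
  let ?P = "length_gf 1 :: int fps" and ?Q = "iprod (\<lambda>i. 1 - fps_X ^ i) :: int fps"
  have "(?P * ?Q) oo fps_X\<^sup>2 = 1" by (simp only: length_gf_1_mult_euler fps_compose_1)
  then have "(?P oo fps_X\<^sup>2) * (?Q oo fps_X\<^sup>2) = 1"
    by (simp add: fps_compose_mult_distrib)
  then have "signed_odd_gf * ?P = signed_odd_gf * ?P * ((?P oo fps_X\<^sup>2) * (?Q oo fps_X\<^sup>2))"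
    by simp
  also have "\<dots> = (signed_odd_gf * (?Q oo fps_X\<^sup>2)) * ?P * (?P oo fps_X\<^sup>2)"
    by (simp only: ac_simps)
  also have "\<dots> = (?P * ?Q) * (?P oo fps_X\<^sup>2)"
    by (simp only: signed_odd_gf_mult_euler ac_simps)
  finally show ?thesis by (simp only: length_gf_1_mult_euler mult_1_left)
qed

text \<open>Euler's theorem on distinct and odd parts, with \<open>?Q\<close> the Euler product:
  \<open>?Q * ?R\<close> is \<open>?Q\<close> at \<open>X\<^sup>2\<close>, and multiplying by
  \<open>signed_odd_gf\<close> gives back \<open>?Q\<close>, which \<open>?P\<close>
  cancels.\<close>

lemma signed_odd_gf_mult_distinct: "signed_odd_gf * iprod (\<lambda>i. 1 + fps_X ^ i) = 1"
proof -
  let ?P = "length_gf 1 :: int fps" and ?Q = "iprod (\<lambda>i. 1 - fps_X ^ i) :: int fps"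
    and ?R = "iprod (\<lambda>i. 1 + fps_X ^ i) :: int fps"
  have "?Q * ?R = iprod (\<lambda>i. (1 - fps_X ^ i) * (1 + fps_X ^ i))"
    by (rule iprod_mult) (auto simp: near_one_def)
  also have "\<dots> = ?Q oo fps_X\<^sup>2"
    unfolding euler_iprod_compose_square
    by (simp add: algebra_simps flip: power_add mult_2)
  finally have QR: "?Q * ?R = ?Q oo fps_X\<^sup>2" .
  have "signed_odd_gf * ?R = signed_odd_gf * ?R * (?P * ?Q)"
    by (simp only: length_gf_1_mult_euler mult_1_right)
  also have "\<dots> = signed_odd_gf * (?Q * ?R) * ?P"
    by (simp only: ac_simps)
  also have "\<dots> = ?P * ?Q"
    by (simp only: QR signed_odd_gf_mult_euler ac_simps)
  finally show ?thesis by (simp only: length_gf_1_mult_euler)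
qed

text \<open>Both sides are inverse to the product of the factors 1 + X^i.\<close>

lemma length_gf_minus_1: "length_gf (-1) = signed_odd_gf"
proof -
  have "length_gf (-1) * iprod (\<lambda>i. 1 + fps_X ^ i :: int fps) = 1"
    using length_gf_mult_iprod[of "-1 :: int"] by (simp flip: fps_const_neg)
  then show ?thesis
    using signed_odd_gf_mult_distinct by (metis mult_right_cancel mult_zero_right zero_neq_one)
qed

section \<open>The crank at fourth roots of unity\<close>

text \<open>Evaluation at \<open>\<i>\<close> needs complex coefficients, while the positivity
  arguments stay over the integers.\<close>

definition cfps :: "int fps \<Rightarrow> complex fps" where
  "cfps f = Abs_fps (\<lambda>n. of_int (f $ n))"

lemma cfps_nth [simp]: "cfps f $ n = of_int (f $ n)"
  by (simp add: cfps_def)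

lemma cfps_1 [simp]: "cfps 1 = 1"
  by (simp add: fps_eq_iff)

lemma cfps_mult: "cfps (f * g) = cfps f * cfps g"
  by (simp add: fps_eq_iff fps_mult_nth)

lemma cfps_power: "cfps (f ^ k) = cfps f ^ k"
  by (induction k) (simp_all add: cfps_mult)

lemma cfps_iprod: "cfps (iprod f) = iprod (\<lambda>i. cfps (f i))"
proof -
  have "cfps (prod f S) = (\<Prod>i\<in>S. cfps (f i))" for S
    by (induction S rule: infinite_finite_induct) (simp_all add: cfps_mult)
  then have "of_int (prod f S $ n) = (\<Prod>i\<in>S. cfps (f i)) $ n" for S n
    by (metis cfps_nth)
  then show ?thesis
    by (simp add: fps_eq_iff iprod_def)
qed

lemma cfps_length_gf: "cfps (length_gf 1) = length_gf 1"
  by (simp add: fps_eq_iff length_gf_def)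

text \<open>Since (1 - \<i> X^j)(1 + \<i> X^j) = 1 + X^(2j), the left side is inverse to
  \<open>?S\<close>; Euler's theorem at \<open>X\<^sup>2\<close> says the same of the right
  side.\<close>

lemma length_gf_ii: "length_gf \<i> * length_gf (-\<i>) = cfps (signed_odd_gf oo fps_X\<^sup>2)"
proof -
  let ?S = "iprod (\<lambda>i. 1 + fps_X ^ (2 * i)) :: complex fps"
  have "iprod (\<lambda>i. 1 + fps_X ^ i) oo fps_X\<^sup>2 = iprod (\<lambda>i. (1 + fps_X ^ i) oo fps_X\<^sup>2 :: int fps)"
    by (rule iprod_compose_square) (auto simp: near_one_def)
  then have "cfps (iprod (\<lambda>i. 1 + fps_X ^ i) oo fps_X\<^sup>2) = iprod (\<lambda>i. cfps (1 + fps_X ^ (2 * i)))"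
    by (simp add: fps_compose_add_distrib fps_X_power_compose cfps_iprod flip: power_mult)
  also have "(\<lambda>i. cfps (1 + fps_X ^ (2 * i))) = (\<lambda>i. 1 + fps_X ^ (2 * i))"
    by (auto simp: fun_eq_iff fps_eq_iff)
  finally have 1: "cfps (signed_odd_gf oo fps_X\<^sup>2) * ?S = 1"
    using signed_odd_gf_mult_distinct
    by (metis cfps_1 cfps_mult fps_compose_1 fps_compose_mult_distrib fps_X_power_nth zero_neq_numeral)
  have "iprod (\<lambda>i. 1 - fps_const \<i> * fps_X ^ i) * iprod (\<lambda>i. 1 - fps_const (-\<i>) * fps_X ^ i)
      = iprod (\<lambda>i. (1 - fps_const \<i> * fps_X ^ i) * (1 - fps_const (-\<i>) * fps_X ^ i))"
    by (rule iprod_mult) (auto intro: near_one_geometric)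
  also have "(\<lambda>i. (1 - fps_const \<i> * fps_X ^ i) * (1 - fps_const (-\<i>) * fps_X ^ i))
      = (\<lambda>i. 1 + fps_X ^ (2 * i))"
  proof
    fix i
    have "(1 - fps_const \<i> * fps_X ^ i) * (1 - fps_const (-\<i>) * fps_X ^ i)
        = 1 - fps_const (\<i> * \<i>) * (fps_X ^ i * fps_X ^ i)"
      by (simp add: algebra_simps flip: fps_const_neg fps_const_mult)
    then show "(1 - fps_const \<i> * fps_X ^ i) * (1 - fps_const (-\<i>) * fps_X ^ i)
        = 1 + fps_X ^ (2 * i)"
      by (simp flip: fps_const_neg power_add mult_2)
  qed
  finally have S: "iprod (\<lambda>i. 1 - fps_const \<i> * fps_X ^ i)
      * iprod (\<lambda>i. 1 - fps_const (-\<i>) * fps_X ^ i) = ?S" .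
  have "length_gf \<i> * length_gf (-\<i>) * ?S
      = (length_gf \<i> * iprod (\<lambda>i. 1 - fps_const \<i> * fps_X ^ i))
        * (length_gf (-\<i>) * iprod (\<lambda>i. 1 - fps_const (-\<i>) * fps_X ^ i))"
    unfolding S[symmetric] by (simp only: ac_simps)
  then have 2: "length_gf \<i> * length_gf (-\<i>) * ?S = 1"
    by (simp only: length_gf_mult_iprod mult_1_left)
  have "length_gf \<i> * length_gf (-\<i>) * ?S = cfps (signed_odd_gf oo fps_X\<^sup>2) * ?S"
    by (simp only: 1 2)
  moreover have "?S \<noteq> 0" using 1 by auto
  ultimately show ?thesis by simp
qed

section \<open>Extracting crank residues modulo 4 from values at roots of unity\<close>

lemma sum_by_residue_mod_4:
  fixes c :: "'b \<Rightarrow> int" and g :: "int \<Rightarrow> 'a::comm_ring_1"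
  assumes "finite A"
  shows "(\<Sum>x\<in>A. g (c x mod 4)) = (\<Sum>r\<in>{0, 1, 2, 3}. of_nat (card {x\<in>A. c x mod 4 = r}) * g r)"
proof -
  have "c x mod 4 \<in> {0, 1, 2, 3}" for x
    using pos_mod_bound[of 4 "c x"] pos_mod_sign[of 4 "c x"] by auto
  then have "(\<Sum>x\<in>A. g (c x mod 4)) = (\<Sum>r\<in>{0, 1, 2, 3}. \<Sum>x\<in>{x\<in>A. c x mod 4 = r}. g (c x mod 4))"
    using assms by (intro sum.group[symmetric]) auto
  then show ?thesis by simp
qed

lemma M_eq: "M k r 4 n = card {ps\<in>colored_partitions k n. crank ps mod 4 = r mod 4}"
  by (simp add: M_def cong_def)

lemma ii_powi_mod_4: "\<i> powi (c mod 4) = \<i> powi c"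
proof -
  have "\<i> powi c = \<i> powi (4 * (c div 4) + c mod 4)" by simp
  also have "\<dots> = (\<i> powi 4) powi (c div 4) * \<i> powi (c mod 4)"
    by (simp only: power_int_add power_int_mult complex_i_not_zero not_False_eq_True simp_thms)
  finally show ?thesis by simp
qed

lemma crank_gf_at_ii:
  fixes k n :: nat
  defines "d \<equiv> ((signed_odd_gf oo fps_X\<^sup>2) * length_gf 1 ^ k) $ n"
  shows "int (M (k + 2) 0 4 n) - int (M (k + 2) 2 4 n) = d" "M (k + 2) 1 4 n = M (k + 2) 3 4 n"
proof -
  let ?C = "colored_partitions (k + 2) n"
  \<comment> \<open>\<open>-\<i>\<close> is the inverse of \<open>\<i>\<close>, so the two weights
    combine to the power of \<open>\<i>\<close> given by the crank.\<close>
  have "\<i> ^ length (ps ! 0) * (-\<i>) ^ length (ps ! 1) = \<i> powi (crank ps mod 4)" for ps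
    unfolding ii_powi_mod_4 crank_def
    by (simp add: power_int_diff divide_inverse flip: power_inverse)
  then have "(\<Sum>ps\<in>?C. \<i> powi (crank ps mod 4))
      = (length_gf \<i> * length_gf (-\<i>) * length_gf 1 ^ k) $ n"
    by (simp flip: crank_gf)
  also have "\<dots> = of_int d"
    by (simp add: length_gf_ii d_def flip: cfps_length_gf cfps_power cfps_mult)
  finally have "of_nat (M (k + 2) 0 4 n) + of_nat (M (k + 2) 1 4 n) * \<i>
      - of_nat (M (k + 2) 2 4 n) - of_nat (M (k + 2) 3 4 n) * \<i> = complex_of_int d"
    by (subst (asm) sum_by_residue_mod_4)
       (simp_all add: finite_colored_partitions M_eq power_int_def numeral_eq_Suc algebra_simps)
  \<comment> \<open>The right side is an integer: real parts give the difference, and the vanishing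
    imaginary part equates residues 1 and 3.\<close>
  from arg_cong[OF this, of Re] arg_cong[OF this, of Im]
  show "int (M (k + 2) 0 4 n) - int (M (k + 2) 2 4 n) = d" "M (k + 2) 1 4 n = M (k + 2) 3 4 n"
    by simp_all
qed

lemma crank_gf_at_minus_1:
  "int (M (k + 2) 0 4 n) - int (M (k + 2) 1 4 n) + int (M (k + 2) 2 4 n) - int (M (k + 2) 3 4 n)
    = (signed_odd_gf\<^sup>2 * length_gf 1 ^ k) $ n"
proof -
  let ?C = "colored_partitions (k + 2) n"
  have "(-1 :: int) ^ length (ps ! 0) * (-1) ^ length (ps ! 1) = (if even (crank ps mod 4) then 1 else -1)"
    for ps
  proof -
    have "even (crank ps mod 4) \<longleftrightarrow> even (crank ps)" by presburger
    then show ?thesis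
      by (auto simp: crank_def minus_one_power_iff)
  qed
  then have "(\<Sum>ps\<in>?C. if even (crank ps mod 4) then 1 else -1)
      = (length_gf (-1) * length_gf (-1) * length_gf (1::int) ^ k) $ n"
    by (simp flip: crank_gf)
  then show ?thesis
    by (subst (asm) sum_by_residue_mod_4)
       (simp_all add: finite_colored_partitions M_eq length_gf_minus_1 power2_eq_square)
qed

section \<open>Positivity of coefficients\<close>

lemma nonneg_odd_factor: "nonneg_fps (if odd i then 1 + fps_X ^ i else 1)"
  by (auto simp: nonneg_fps_def)

lemma near_one_odd_factor: "near_one (\<lambda>i. if odd i then 1 + fps_X ^ i else 1)"
  by (auto simp: near_one_def)

lemma nonneg_odd_distinct_gf: "nonneg_fps odd_distinct_gf"
  unfolding odd_distinct_gf_def by (rule nonneg_fps_iprod) (rule nonneg_odd_factor)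

lemma odd_distinct_gf_ge:
  assumes "S \<subseteq> {1..n}" "\<forall>i\<in>S. odd i"
  shows "(\<Prod>i\<in>S. 1 + fps_X ^ i) $ n \<le> odd_distinct_gf $ n"
proof -
  have "(\<Prod>i\<in>S. 1 + fps_X ^ i) = (\<Prod>i\<in>S. if odd i then 1 + fps_X ^ i else 1 :: int fps)"
    using assms(2) by (intro prod.cong) auto
  then show ?thesis
    unfolding odd_distinct_gf_def
    using iprod_nth_ge[OF near_one_odd_factor nonneg_odd_factor assms(1)] by simp
qed

lemma odd_distinct_gf_0 [simp]: "odd_distinct_gf $ 0 = 1"
  by (simp add: odd_distinct_gf_def iprod_def)

text \<open>Witnesses are the single part \<open>n\<close> for odd \<open>n\<close> and the parts
  \<open>n - 1\<close> and 1 for even \<open>n\<close> from 4 on. For \<open>n = 2\<close> these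
  would be 1 + 1, which repeats a part.\<close>

lemma odd_distinct_gf_pos:
  assumes "n \<noteq> 2"
  shows "odd_distinct_gf $ n \<ge> 1"
proof -
  have "n = 0 \<or> odd n \<or> (even n \<and> n \<ge> 4)"
    using assms by presburger
  then consider "n = 0" | "odd n" | "even n" "n \<ge> 4"
    by blast
  then show ?thesis
  proof cases
    case 2
    then show ?thesis using odd_distinct_gf_ge[of "{n}" n] by (cases n) auto
  next
    case 3
    then have "(\<Prod>i\<in>{1, n - 1}. 1 + fps_X ^ i :: int fps) $ n = ((1 + fps_X) * (1 + fps_X ^ (n - 1))) $ n"
      by (subst prod.insert) auto
    also have "\<dots> = 1"
      using 3 by (auto simp: distrib_right)
    finally show ?thesis using 3 odd_distinct_gf_ge[of "{1, n - 1}" n] by auto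
  qed simp
qed

lemma length_gf_1_pos: "length_gf (1 :: int) $ n \<ge> 1"
proof -
  have "(if n = 0 then [] else [n]) \<in> partitions n"
    by (simp add: partitions_def is_partition_def)
  then have "card (partitions n) > 0"
    using finite_partitions card_gt_0_iff by blast
  then show ?thesis by (simp add: length_gf_def)
qed

lemma nonneg_length_gf: "nonneg_fps (length_gf 1)"
  using length_gf_1_pos by (meson nonneg_fps_def order_trans zero_le_one)

text \<open>The end terms \<open>j = 0\<close> and \<open>j = 2 * m\<close> contribute at least 2,
  which makes the inequality strict; the middle term is a square.\<close>

lemma nth_square_odd_distinct_gf:
  assumes "m \<ge> 2"
  shows "(odd_distinct_gf\<^sup>2) $ (2 * m) > odd_distinct_gf $ m"
proof -
  let ?q = "\<lambda>n. odd_distinct_gf $ n"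
  have "(\<Sum>j\<in>{0, m, 2 * m}. ?q j * ?q (2 * m - j)) \<le> (odd_distinct_gf\<^sup>2) $ (2 * m)"
    unfolding power2_eq_square by (intro nth_mult_ge nonneg_odd_distinct_gf) auto
  then have "2 * ?q (2 * m) + ?q m * ?q m \<le> (odd_distinct_gf\<^sup>2) $ (2 * m)"
    using assms by simp
  moreover have "?q (2 * m) \<ge> 1" using assms by (intro odd_distinct_gf_pos) auto
  \<comment> \<open>The coefficient is 0 for \<open>m = 2\<close>, so only the integer inequality
    x^2 \<ge> x for x \<ge> 0 is available.\<close>
  moreover have "?q m * ?q m \<ge> ?q m"
  proof (cases "?q m = 0")
    case False
    then have "?q m \<ge> 1"
      using nonneg_odd_distinct_gf by (metis nonneg_fps_def int_one_le_iff_zero_less order_less_le)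
    then show ?thesis using mult_right_mono[of 1 "?q m" "?q m"] by simp
  qed simp
  ultimately show ?thesis by linarith
qed

lemma nth_square_odd_distinct_gf_pos:
  assumes "n \<noteq> 2"
  shows "(odd_distinct_gf\<^sup>2) $ n \<ge> 1"
proof -
  have "(\<Sum>j\<in>{0}. odd_distinct_gf $ j * odd_distinct_gf $ (n - j)) \<le> (odd_distinct_gf\<^sup>2) $ n"
    unfolding power2_eq_square by (intro nth_mult_ge nonneg_odd_distinct_gf) auto
  then show ?thesis using odd_distinct_gf_pos[OF assms] by simp
qed

lemma nth_square_signed_odd_gf: "(signed_odd_gf\<^sup>2) $ n = (-1) ^ n * (odd_distinct_gf\<^sup>2) $ n"
proof -
  have "signed_odd_gf\<^sup>2 = odd_distinct_gf\<^sup>2 oo - fps_X"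
    by (simp add: fps_compose_power)
  then show ?thesis by (simp add: fps_compose_uminus')
qed

text \<open>The series T of the overview: the crank series for three colors is T(q) at z = \<i> and
  T(-q) at z = -1.\<close>

definition three_colored_gf :: "int fps" where
  "three_colored_gf = odd_distinct_gf * (length_gf 1 oo fps_X\<^sup>2)"

lemma three_colored_gf_eq: "(signed_odd_gf oo fps_X\<^sup>2) * length_gf 1 = three_colored_gf"
  unfolding three_colored_gf_def odd_distinct_gf_mult_signed[symmetric]
    signed_odd_gf_mult_length_gf[symmetric] by (simp only: mult.assoc)

lemma three_colored_gf_compose: "signed_odd_gf\<^sup>2 * length_gf 1 = three_colored_gf oo - fps_X"
proof -
  have "three_colored_gf oo - fps_X = signed_odd_gf * ((length_gf 1 oo fps_X\<^sup>2) oo - fps_X)"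
    by (simp add: three_colored_gf_def fps_compose_mult_distrib)
  \<comment> \<open>A series in \<open>X\<^sup>2\<close> is unchanged by the sign change of
    \<open>X\<close>.\<close>
  also have "(length_gf 1 oo fps_X\<^sup>2) oo - fps_X = (length_gf 1 oo fps_X\<^sup>2 :: int fps)"
    by (auto simp: fps_eq_iff fps_compose_uminus' fps_nth_compose_X_power)
  also note signed_odd_gf_mult_length_gf[symmetric]
  finally show ?thesis by (simp add: power2_eq_square mult.assoc)
qed

lemma nonneg_three_colored_gf: "nonneg_fps three_colored_gf"
  unfolding three_colored_gf_def
  using nonneg_length_gf
  by (intro nonneg_fps_mult nonneg_odd_distinct_gf)
     (simp add: nonneg_fps_def fps_nth_compose_X_power)

text \<open>The index \<open>j = n mod 2\<close> has a positive coefficient in the first factor and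
  leaves an even remainder for the second.\<close>

lemma three_colored_gf_pos: "three_colored_gf $ n \<ge> 1"
proof -
  have "(\<Sum>j\<in>{n mod 2}. odd_distinct_gf $ j * (length_gf 1 oo fps_X\<^sup>2) $ (n - j)) \<le> three_colored_gf $ n"
    unfolding three_colored_gf_def
    using nonneg_length_gf
    by (intro nth_mult_ge nonneg_odd_distinct_gf)
       (auto simp: nonneg_fps_def fps_nth_compose_X_power)
  moreover have "2 dvd n - n mod 2" by simp
  ultimately have "odd_distinct_gf $ (n mod 2) * length_gf 1 $ ((n - n mod 2) div 2) \<le> three_colored_gf $ n"
    by (simp add: fps_nth_compose_X_power)
  moreover have "1 * 1 \<le> odd_distinct_gf $ (n mod 2) * length_gf 1 $ ((n - n mod 2) div 2)"
    using length_gf_1_pos odd_distinct_gf_pos[of "n mod 2"] nonneg_odd_distinct_gf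
    by (intro mult_mono) (auto simp: nonneg_fps_def)
  ultimately show ?thesis by linarith
qed

lemma length_gf_power_pos: "(length_gf (1::int) ^ Suc k) $ n \<ge> 1"
proof (induction k arbitrary: n)
  case (Suc k)
  have "nonneg_fps (length_gf 1 ^ Suc k)"
    using Suc.IH by (meson nonneg_fps_def order_trans zero_le_one)
  then have "(\<Sum>j\<in>{0}. length_gf (1::int) $ j * (length_gf 1 ^ Suc k) $ (n - j))
      \<le> (length_gf 1 * length_gf 1 ^ Suc k) $ n"
    by (intro nth_mult_ge nonneg_length_gf) auto
  moreover have "1 * 1 \<le> length_gf (1::int) $ 0 * (length_gf 1 ^ Suc k) $ n"
    using length_gf_1_pos Suc.IH nonneg_length_gf
    by (intro mult_mono) (auto simp: nonneg_fps_def)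
  ultimately show ?case by simp
qed (simp add: length_gf_1_pos)

text \<open>Adding or subtracting the two products doubles the even or the odd coefficients of
  \<open>f\<close> and removes the others. Indices 0 and 1 keep both results positive; index 1 is
  within range as \<open>n > 0\<close>.\<close>

lemma nth_mult_compose_uminus_less:
  assumes "nonneg_fps f" "\<And>n. g $ n \<ge> 1" "f $ 0 \<ge> 1" "f $ 1 \<ge> 1" "n > 0"
  shows "\<bar>((f oo - fps_X) * g) $ n\<bar> < (f * g) $ n"
proof -
  have g: "nonneg_fps g" using assms(2) by (meson nonneg_fps_def order_trans zero_le_one)
  have even_part: "0 < (f * g) $ n + ((f oo - fps_X) * g) $ n"
  proof -
    have "(f * g) $ n + ((f oo - fps_X) * g) $ n
        = (\<Sum>j=0..n. (if even j then 2 * f $ j else 0) * g $ (n - j))"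
      unfolding fps_mult_nth sum.distrib[symmetric]
      by (intro sum.cong) (auto simp: fps_compose_uminus')
    also have "\<dots> > 0"
      using assms(1,3) g assms(2)[of n]
      by (intro sum_pos2[where i = 0]) (auto simp: nonneg_fps_def)
    finally show ?thesis .
  qed
  have odd_part: "0 < (f * g) $ n - ((f oo - fps_X) * g) $ n"
  proof -
    have "(f * g) $ n - ((f oo - fps_X) * g) $ n
        = (\<Sum>j=0..n. (if odd j then 2 * f $ j else 0) * g $ (n - j))"
      unfolding fps_mult_nth sum_subtractf[symmetric]
      by (intro sum.cong) (auto simp: fps_compose_uminus')
    also have "\<dots> > 0"
      using assms(1,4,5) g assms(2)[of "n - 1"]
      by (intro sum_pos2[where i = 1]) (auto simp: nonneg_fps_def)
    finally show ?thesis .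
  qed
  from even_part odd_part show ?thesis by linarith
qed

section \<open>Differences of crank counts as coefficients\<close>

lemma M_2_diffs:
  "int (M 2 0 4 n) - int (M 2 2 4 n) = (if even n then (-1) ^ (n div 2) * odd_distinct_gf $ (n div 2) else 0)"
  "int (M 2 0 4 n) + int (M 2 2 4 n) - 2 * int (M 2 1 4 n) = (-1) ^ n * (odd_distinct_gf\<^sup>2) $ n"
  using crank_gf_at_ii[where k = 0 and n = n] crank_gf_at_minus_1[where k = 0 and n = n]
  by (simp_all only: add_0 power_0 mult_1_right fps_nth_compose_X_power signed_odd_gf_nth
      nth_square_signed_odd_gf)

text \<open>One factor \<open>length_gf 1\<close> is absorbed into \<open>three_colored_gf\<close>,
  leaving the power \<open>k\<close> for \<open>k + 3\<close> colors.\<close>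

lemma M_ge_3_diffs:
  "int (M (k + 3) 0 4 n) - int (M (k + 3) 2 4 n) = (three_colored_gf * length_gf 1 ^ k) $ n"
  "int (M (k + 3) 0 4 n) + int (M (k + 3) 2 4 n) - 2 * int (M (k + 3) 1 4 n)
    = ((three_colored_gf oo - fps_X) * length_gf 1 ^ k) $ n"
proof -
  have k: "Suc k + 2 = k + 3" by simp
  show "int (M (k + 3) 0 4 n) - int (M (k + 3) 2 4 n) = (three_colored_gf * length_gf 1 ^ k) $ n"
    using crank_gf_at_ii(1)[where k = "Suc k" and n = n]
    unfolding three_colored_gf_eq[symmetric] k by (simp only: power_Suc mult.assoc)
  show "int (M (k + 3) 0 4 n) + int (M (k + 3) 2 4 n) - 2 * int (M (k + 3) 1 4 n)
    = ((three_colored_gf oo - fps_X) * length_gf 1 ^ k) $ n"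
    using crank_gf_at_ii(2)[where k = "Suc k" and n = n] crank_gf_at_minus_1[where k = "Suc k" and n = n]
    unfolding three_colored_gf_compose[symmetric] k by (simp add: mult.assoc)
qed

theorem theorem2p5:
  fixes n :: nat
  assumes "n > 0"
  shows "(n \<noteq> 1 \<longrightarrow> M 2 0 4 (4*n) > M 2 2 4 (4*n) \<and> M 2 2 4 (4*n) > M 2 1 4 (4*n)) \<and>
    (M 2 2 4 (4*n+2) > M 2 0 4 (4*n+2) \<and> M 2 0 4 (4*n+2) > M 2 1 4 (4*n+2)) \<and>
    (M 2 1 4 (2*n+1) > M 2 0 4 (2*n+1) \<and> M 2 0 4 (2*n+1) = M 2 2 4 (2*n+1)) \<and>
    (M 3 0 4 (2*n) > M 3 1 4 (2*n) \<and> M 3 1 4 (2*n) = M 3 2 4 (2*n)) \<and>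
    (M 3 0 4 (2*n+1) = M 3 1 4 (2*n+1) \<and> M 3 1 4 (2*n+1) > M 3 2 4 (2*n+1)) \<and>
    (\<forall>k\<ge>4. M k 0 4 n > M k 1 4 n \<and> M k 1 4 n > M k 2 4 n)"
proof (intro conjI)
  have half: "4 * n div 2 = 2 * n" "(4 * n + 2) div 2 = 2 * n + 1" by auto
  show "n \<noteq> 1 \<longrightarrow> M 2 0 4 (4*n) > M 2 2 4 (4*n) \<and> M 2 2 4 (4*n) > M 2 1 4 (4*n)"
  proof
    \<comment> \<open>For \<open>n = 1\<close> the coefficient at 2 vanishes and the first
      inequality becomes an equality.\<close>
    assume "n \<noteq> 1"
    then have "odd_distinct_gf $ (2 * n) \<ge> 1" by (intro odd_distinct_gf_pos) auto
    moreover have "(odd_distinct_gf\<^sup>2) $ (4 * n) > odd_distinct_gf $ (2 * n)"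
      using nth_square_odd_distinct_gf[of "2 * n"] assms by simp
    ultimately show "M 2 0 4 (4*n) > M 2 2 4 (4*n) \<and> M 2 2 4 (4*n) > M 2 1 4 (4*n)"
      using M_2_diffs[of "4 * n"] by (simp add: half)
  qed
  have "odd_distinct_gf $ (2 * n + 1) \<ge> 1" by (intro odd_distinct_gf_pos) presburger
  moreover have "(odd_distinct_gf\<^sup>2) $ (4 * n + 2) > odd_distinct_gf $ (2 * n + 1)"
    using nth_square_odd_distinct_gf[of "2 * n + 1"] assms by simp
  \<comment> \<open>The halved index \<open>2 * n + 1\<close> is odd, and its sign reverses the
    order of residues 0 and 2.\<close>
  moreover have "int (M 2 0 4 (4*n+2)) - int (M 2 2 4 (4*n+2)) = - (odd_distinct_gf $ (2 * n + 1))"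
    "int (M 2 0 4 (4*n+2)) + int (M 2 2 4 (4*n+2)) - 2 * int (M 2 1 4 (4*n+2))
      = (odd_distinct_gf\<^sup>2) $ (4 * n + 2)"
    unfolding M_2_diffs half by simp_all
  ultimately show "M 2 2 4 (4*n+2) > M 2 0 4 (4*n+2)" "M 2 0 4 (4*n+2) > M 2 1 4 (4*n+2)"
    by linarith+
  have "(odd_distinct_gf\<^sup>2) $ (2 * n + 1) \<ge> 1" by (intro nth_square_odd_distinct_gf_pos) presburger
  moreover have "int (M 2 0 4 (2*n+1)) - int (M 2 2 4 (2*n+1)) = 0"
    "int (M 2 0 4 (2*n+1)) + int (M 2 2 4 (2*n+1)) - 2 * int (M 2 1 4 (2*n+1))
      = - ((odd_distinct_gf\<^sup>2) $ (2 * n + 1))"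
    unfolding M_2_diffs by simp_all
  ultimately show "M 2 1 4 (2*n+1) > M 2 0 4 (2*n+1)" "M 2 0 4 (2*n+1) = M 2 2 4 (2*n+1)"
    by linarith+
  \<comment> \<open>The sum of the two differences is twice M0 - M1, and the first minus the second
    is twice M1 - M2; the parity of \<open>m\<close> decides which one vanishes.\<close>
  have M3: "int (M 3 0 4 m) - int (M 3 2 4 m) = three_colored_gf $ m"
    "int (M 3 0 4 m) + int (M 3 2 4 m) - 2 * int (M 3 1 4 m) = (-1) ^ m * three_colored_gf $ m" for m
    using M_ge_3_diffs[of 0 m] by (simp_all add: fps_compose_uminus')
  show "M 3 0 4 (2*n) > M 3 1 4 (2*n)" "M 3 1 4 (2*n) = M 3 2 4 (2*n)"
    using M3[of "2 * n"] three_colored_gf_pos[of "2 * n"] by simp_all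
  show "M 3 0 4 (2*n+1) = M 3 1 4 (2*n+1)" "M 3 1 4 (2*n+1) > M 3 2 4 (2*n+1)"
    using M3[of "2 * n + 1"] three_colored_gf_pos[of "2 * n + 1"] by simp_all
  show "\<forall>k\<ge>4. M k 0 4 n > M k 1 4 n \<and> M k 1 4 n > M k 2 4 n"
  proof (intro allI impI)
    fix k :: nat assume "k \<ge> 4"
    then have "k = Suc (k - 4) + 3" by simp
    \<comment> \<open>From four colors on, at least one factor \<open>length_gf 1\<close> remains,
      and its powers have only positive coefficients.\<close>
    then obtain l where k: "k = Suc l + 3" by blast
    have "\<bar>((three_colored_gf oo - fps_X) * length_gf 1 ^ Suc l) $ n\<bar>
        < (three_colored_gf * length_gf 1 ^ Suc l) $ n"
      using assms
      by (intro nth_mult_compose_uminus_less nonneg_three_colored_gf three_colored_gf_pos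
          length_gf_power_pos)
    then show "M k 0 4 n > M k 1 4 n \<and> M k 1 4 n > M k 2 4 n"
      using M_ge_3_diffs[of "Suc l" n] unfolding k by linarith
  qed
qed

end
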